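(* For every constant $e>0$, problem $\mathcal{W}(1,ed)$ admits a solution by algorithm $\mathrm{Naive}(s,r)$ with speeds $s=r=\sqrt{e/3}$ if $e<3$, and $s=r=1$ if $e\ge3$. The induced evacuation time on instance $d$ is $g(e)\,d$, where $g(e)=3\sqrt{3/e}$ for $e<3$ and $g(e)=3$ for $e\ge3$.
   Context: Two robots start at the origin of the infinite real line. An exit is placed at an unknown point at distance $d>0$ from the origin (either at $d$ or at $-d$; either placement is called an instance $d$). A robot finds the exit if and only if it walks over it. Robots may change speed and direction at any time, and communicate wirelessly: messages are transmitted instantaneously at any distance. The evacuation time is the time at which the last robot reaches the exit. A robot moving at constant speed $s$ over a segment of length $x$ uses energy $xs^2$, and energies of successive intervals add up. The makespan evacuation energy is the maximum of the two robots' energies used until both have reached the exit. Problem $\mathcal{W}(1,ed)$: minimize the evacuation time over algorithms using speeds at most $1$ whose makespan evacuation energy is at most $ed$ for every instance $d$ (the algorithm does not know $d$ but knows $e$). Algorithm $\mathrm{Naive}(s,r)$: the two robots move in opposite directions with speed $s$ until the exit is found; the finder announces "exit found" and halts; the other robot turns around and moves at speed $r$ until it reaches the exit. *)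

theory Defs
  imports Complex_Main
begin

datatype robot = Robot1 | Robot2

text \<open>
  A trajectory maps time to the position on the line.
  \<open>moves b p a c E\<close>: on the time interval \<open>[a, c]\<close> the trajectory \<open>p\<close> consists of finitely many
  stretches of constant velocity, of speed at most \<open>b\<close>, and uses energy \<open>E\<close> in total. A stretch of
  length \<open>x\<close> covered at speed \<open>s\<close> costs \<open>x * s\<^sup>2\<close>; waiting (speed \<open>0\<close>) is free.
\<close>
inductive moves :: "real \<Rightarrow> (real \<Rightarrow> real) \<Rightarrow> real \<Rightarrow> real \<Rightarrow> real \<Rightarrow> bool"
  for b :: real and p :: "real \<Rightarrow> real" where
  const: "a \<le> c \<Longrightarrow> \<bar>v\<bar> \<le> b \<Longrightarrow> (\<And>t. a \<le> t \<Longrightarrow> t \<le> c \<Longrightarrow> p t = p a + v * (t - a)) \<Longrightarrow>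
    moves b p a c (\<bar>p c - p a\<bar> * \<bar>v\<bar>\<^sup>2)"
| add: "moves b p a m E \<Longrightarrow> moves b p m c F \<Longrightarrow> moves b p a c (E + F)"

definition trajectory :: "real \<Rightarrow> (real \<Rightarrow> real) \<Rightarrow> bool" where
  "trajectory b p \<longleftrightarrow> p 0 = 0 \<and> (\<forall>T\<ge>0. \<exists>E. moves b p 0 T E)"

text \<open>
  \<open>search A i t\<close> is the position of robot \<open>i\<close> at time \<open>t\<close> as long as the exit has not been found.
  \<open>respond A y i u\<close> is its position \<open>u\<close> time units after the announcement that the exit was found
  at \<open>y\<close>. As messages are instantaneous, both robots may react to \<open>y\<close> from the time of discovery
  on; before it, their motion cannot depend on \<open>y\<close>.
\<close>
record algorithm =
  search :: "robot \<Rightarrow> real \<Rightarrow> real"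
  respond :: "real \<Rightarrow> robot \<Rightarrow> real \<Rightarrow> real"

definition find_time :: "algorithm \<Rightarrow> real \<Rightarrow> real" where
  "find_time A y = Inf {t. 0 \<le> t \<and> (\<exists>i. search A i t = y)}"

definition run :: "algorithm \<Rightarrow> real \<Rightarrow> robot \<Rightarrow> real \<Rightarrow> real" where
  "run A y i t =
     (if t \<le> find_time A y then search A i t else respond A y i (t - find_time A y))"

definition reach_time :: "algorithm \<Rightarrow> real \<Rightarrow> robot \<Rightarrow> real" where
  "reach_time A y i = Inf {t. 0 \<le> t \<and> run A y i t = y}"

definition evacuation_time :: "algorithm \<Rightarrow> real \<Rightarrow> real" where
  "evacuation_time A y = max (reach_time A y Robot1) (reach_time A y Robot2)"

text \<open>
  The algorithm, with speeds at most \<open>b\<close>, evacuates both robots if the exit is at \<open>y\<close>. The first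
  two conditions constrain the motion at all times, so that the infima in \<^const>\<open>find_time\<close> and
  \<^const>\<open>reach_time\<close> are attained (trajectories are continuous, the last two conditions make the
  sets nonempty).
\<close>
definition evacuates :: "real \<Rightarrow> algorithm \<Rightarrow> real \<Rightarrow> bool" where
  "evacuates b A y \<longleftrightarrow>
     (\<forall>i. trajectory b (search A i)) \<and>
     (\<forall>i. trajectory b (run A y i)) \<and>
     (\<exists>t\<ge>0. \<exists>i. search A i t = y) \<and>
     (\<forall>i. \<exists>t\<ge>0. run A y i t = y)"

definition makespan_energy :: "real \<Rightarrow> algorithm \<Rightarrow> real \<Rightarrow> real \<Rightarrow> bool" where
  "makespan_energy b A y M \<longleftrightarrow>
     (\<exists>E1 E2. moves b (run A y Robot1) 0 (evacuation_time A y) E1 \<and>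
              moves b (run A y Robot2) 0 (evacuation_time A y) E2 \<and>
              M = max E1 E2)"

text \<open>
  The problem with speed bound \<open>b\<close> and energy budget \<open>\<Delta> d\<close> on instance \<open>d\<close>. The algorithm is fixed
  before \<open>d\<close> and the side of the exit are.
\<close>
definition W_feasible :: "real \<Rightarrow> (real \<Rightarrow> real) \<Rightarrow> algorithm \<Rightarrow> bool" where
  "W_feasible b \<Delta> A \<longleftrightarrow>
     (\<forall>d>0. \<forall>y\<in>{d, - d}. evacuates b A y \<and> (\<exists>M. makespan_energy b A y M \<and> M \<le> \<Delta> d))"

text \<open>The evacuation time on distance \<open>d\<close> is that of the worse of the two placements.\<close>
definition worst_time :: "algorithm \<Rightarrow> real \<Rightarrow> real" where
  "worst_time A d = max (evacuation_time A d) (evacuation_time A (- d))"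

definition W_solution :: "real \<Rightarrow> (real \<Rightarrow> real) \<Rightarrow> algorithm \<Rightarrow> bool" where
  "W_solution b \<Delta> A \<longleftrightarrow>
     W_feasible b \<Delta> A \<and>
     (\<forall>A'. W_feasible b \<Delta> A' \<longrightarrow> (\<forall>d>0. worst_time A d \<le> worst_time A' d))"

definition naive_search :: "real \<Rightarrow> robot \<Rightarrow> real \<Rightarrow> real" where
  "naive_search s i t = (case i of Robot1 \<Rightarrow> s * t | Robot2 \<Rightarrow> - (s * t))"

text \<open>
  At the announcement, at time \<open>\<bar>y\<bar> / s\<close>, the finder is at \<open>y\<close> and halts; the other robot is on the
  opposite side and walks towards \<open>y\<close> at speed \<open>r\<close> until it gets there.
\<close>
definition naive :: "real \<Rightarrow> real \<Rightarrow> algorithm" where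
  "naive s r =
     \<lparr>search = naive_search s,
      respond = (\<lambda>y i u.
        let x = naive_search s i (\<bar>y\<bar> / s)
        in if x = y then y else x + sgn (y - x) * min (r * u) \<bar>y - x\<bar>)\<rparr>"

end

theory Submission
  imports Defs "HOL-Analysis.Lipschitz"
begin

text \<open>
  Let \<open>y\<close> be whichever of \<open>d\<close> and \<open>- d\<close> is visited first during the search, by robot \<open>i\<close> say. If the
  exit is at \<open>- y\<close>, then robot \<open>i\<close> still visits \<open>y\<close> before it learns anything, so it walks from \<open>0\<close>
  to \<open>y\<close> and then to \<open>- y\<close>, a distance of at least \<open>3 * d\<close>. At speed at most \<open>1\<close> this takes time at
  least \<open>3 * d\<close>; and since \<open>v\<^sup>3\<close> lies above its tangent at \<open>s\<close>, a walk of length \<open>L\<close> and duration \<open>T\<close>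
  costs at least \<open>3 * s\<^sup>2 * L - 2 * s\<^sup>3 * T\<close>, which for \<open>s = sqrt (e / 3)\<close> and energy at most
  \<open>e * d\<close> forces \<open>T \<ge> 3 * d / s\<close>. The naive algorithm attains both bounds.
\<close>

section \<open>Displacement and energy of piecewise linear motion\<close>

text \<open>On an affine stretch the length is speed times duration, so the cost turns into speed
  cubed times duration. The free intercept \<open>q\<close> lets later stretches be given by any
  convenient formula.\<close>

lemma moves_linear:
  assumes "a \<le> c" "\<bar>v\<bar> \<le> b" "\<And>t. a \<le> t \<Longrightarrow> t \<le> c \<Longrightarrow> p t = q + v * t"
  shows "moves b p a c (\<bar>v\<bar> ^ 3 * (c - a))"
proof -
  have "p t = p a + v * (t - a)" if "a \<le> t" "t \<le> c" for t
    using assms(1) assms(3)[of t] assms(3)[of a] that by (simp add: algebra_simps)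
  then have "moves b p a c (\<bar>p c - p a\<bar> * \<bar>v\<bar>\<^sup>2)"
    by (rule moves.const[OF assms(1,2)])
  moreover have "p c - p a = v * (c - a)"
    using assms(1) assms(3)[of c] assms(3)[of a] by (simp add: algebra_simps)
  ultimately show ?thesis
    using assms(1) by (simp add: abs_mult power3_eq_cube power2_eq_square mult_ac)
qed

text \<open>The cut falls inside a single constant stretch (or at an end of one); its two pieces
  keep the velocity, and their energies are proportional to their durations.\<close>

lemma moves_split:
  assumes "moves b p a c E" "a \<le> m" "m \<le> c"
  obtains E1 E2 where "moves b p a m E1" "moves b p m c E2" "E = E1 + E2"
proof -
  from assms have "\<exists>E1 E2. moves b p a m E1 \<and> moves b p m c E2 \<and> E = E1 + E2"
  proof (induction arbitrary: m rule: moves.induct)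
    case (const a c v)
    define q where "q = p a - v * a"
    have lin: "p t = q + v * t" if "a \<le> t" "t \<le> c" for t
      using const(3)[OF that] by (simp add: q_def algebra_simps)
    have "moves b p a m (\<bar>v\<bar> ^ 3 * (m - a))" "moves b p m c (\<bar>v\<bar> ^ 3 * (c - m))"
      using const(2,4,5) lin by (auto intro!: moves_linear[where q = q])
    moreover have "\<bar>p c - p a\<bar> = \<bar>v\<bar> * (c - a)"
      using const(3)[of c] const(1) by (simp add: abs_mult)
    then have "\<bar>p c - p a\<bar> * \<bar>v\<bar>\<^sup>2 = \<bar>v\<bar> ^ 3 * (m - a) + \<bar>v\<bar> ^ 3 * (c - m)"
      by (simp only:) (simp add: power3_eq_cube power2_eq_square algebra_simps)
    ultimately show ?case by blast
  next
    case (add a k E c F)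
    show ?case
    proof (cases "m \<le> k")
      case True
      then obtain E1 E2 where "moves b p a m E1" "moves b p m k E2" "E = E1 + E2"
        using add.IH(1) add.prems by blast
      then show ?thesis
        using moves.add[OF _ add.hyps(2)] by (metis add.assoc)
    next
      case False
      then obtain F1 F2 where "moves b p k m F1" "moves b p m c F2" "F = F1 + F2"
        using add.IH(2) add.prems by (meson linear)
      then show ?thesis
        using moves.add[OF add.hyps(1)] by (metis add.assoc)
    qed
  qed
  then show thesis using that by blast
qed

lemma moves_displacement_le: "moves b p a c E \<Longrightarrow> \<bar>p c - p a\<bar> \<le> b * (c - a)"
proof (induction rule: moves.induct)
  case (const a c v)
  have "p c - p a = v * (c - a)" using const(3)[of c] const(1) by simp
  then show ?case using const(1,2) by (simp add: abs_mult mult_right_mono)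
next
  case (add a m E c F)
  then show ?case by (simp add: algebra_simps)
qed

lemma cube_ge_tangent:
  fixes x s :: real
  assumes "0 \<le> x" "0 \<le> s"
  shows "3 * s\<^sup>2 * x - 2 * s ^ 3 \<le> x ^ 3"
proof -
  have "x ^ 3 - (3 * s\<^sup>2 * x - 2 * s ^ 3) = (x - s)\<^sup>2 * (x + 2 * s)"
    by (simp add: power3_eq_cube power2_eq_square algebra_simps)
  also have "\<dots> \<ge> 0" using assms by simp
  finally show ?thesis by simp
qed

text \<open>The tangent inequality is linear in length and duration, so it can be summed over
  stretches of any lengths. The triangle inequality then replaces the path length by the
  displacement.\<close>

lemma moves_energy_ge:
  assumes "moves b p a c E" "0 \<le> s"
  shows "3 * s\<^sup>2 * \<bar>p c - p a\<bar> - 2 * s ^ 3 * (c - a) \<le> E"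
  using assms(1)
proof (induction rule: moves.induct)
  case (const a c v)
  have d: "\<bar>p c - p a\<bar> = \<bar>v\<bar> * (c - a)" using const(3)[of c] const(1) by (simp add: abs_mult)
  have "(3 * s\<^sup>2 * \<bar>v\<bar> - 2 * s ^ 3) * (c - a) \<le> \<bar>v\<bar> ^ 3 * (c - a)"
    using cube_ge_tangent[of "\<bar>v\<bar>" s] assms(2) const(1) by (intro mult_right_mono) auto
  then show ?case unfolding d by (simp add: power3_eq_cube power2_eq_square algebra_simps)
next
  case (add a m E c F)
  have "3 * s\<^sup>2 * \<bar>p c - p a\<bar> \<le> 3 * s\<^sup>2 * (\<bar>p m - p a\<bar> + \<bar>p c - p m\<bar>)"
    by (intro mult_left_mono) auto
  with add.IH show ?case by (simp add: algebra_simps)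
qed

section \<open>Continuity of trajectories and attained infima\<close>

lemma trajectory_lipschitz:
  assumes "trajectory b p" "0 \<le> t" "t \<le> u"
  shows "\<bar>p u - p t\<bar> \<le> b * (u - t)"
proof -
  obtain E where "moves b p 0 u E"
    using assms unfolding trajectory_def by (meson order_trans)
  then obtain E' where "moves b p t u E'"
    using assms by (meson moves_split)
  then show ?thesis by (rule moves_displacement_le)
qed

lemma trajectory_continuous_on:
  assumes "trajectory b p"
  shows "continuous_on {0..} p"
proof -
  \<comment> \<open>A Lipschitz constant has to be nonnegative, and no sign of \<open>b\<close> is
    assumed.\<close>
  have "\<bar>b\<bar>-lipschitz_on {0..} p"
  proof (rule lipschitz_on_leI)
    fix t u :: real assume "t \<in> {0..}" "u \<in> {0..}" "t \<le> u"
    then have "\<bar>p u - p t\<bar> \<le> b * (u - t)" using trajectory_lipschitz[OF assms] by simp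
    also have "\<dots> \<le> \<bar>b\<bar> * (u - t)" using \<open>t \<le> u\<close> by (intro mult_right_mono) auto
    finally show "dist (p t) (p u) \<le> \<bar>b\<bar> * dist t u"
      using \<open>t \<le> u\<close> by (simp add: dist_real_def abs_minus_commute)
  qed simp
  then show ?thesis by (rule lipschitz_on_continuous_on)
qed

lemma trajectory_closed_preimage:
  assumes "trajectory b p"
  shows "closed {t. 0 \<le> t \<and> p t = y}"
proof -
  have "closed ({0..} \<inter> p -` {y})"
    using continuous_closed_preimage[OF trajectory_continuous_on[OF assms]] by simp
  moreover have "{0..} \<inter> p -` {y} = {t. 0 \<le> t \<and> p t = y}" by auto
  ultimately show ?thesis by simp
qed

lemma robot_UNIV: "UNIV = {Robot1, Robot2}"
  using robot.exhaust by auto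

text \<open>With two robots, the set of finding times is a finite union of closed sets. Being
  closed, nonempty and bounded below, it contains its infimum.\<close>

lemma find_time_attained:
  assumes "\<And>i. trajectory b (search A i)" "0 \<le> t" "search A j t = y"
  shows "0 \<le> find_time A y \<and> (\<exists>i. search A i (find_time A y) = y)"
proof -
  let ?S = "{t. 0 \<le> t \<and> (\<exists>i. search A i t = y)}"
  have "?S = (\<Union>i. {t. 0 \<le> t \<and> search A i t = y})" by auto
  moreover have "closed (\<Union>i. {t. 0 \<le> t \<and> search A i t = y})"
    using assms(1) by (intro closed_UN) (auto simp: robot_UNIV intro: trajectory_closed_preimage)
  ultimately have "closed ?S" by simp
  then have "Inf ?S \<in> ?S"
    using assms by (intro closed_contains_Inf) (auto intro!: bdd_belowI[of _ 0])
  then show ?thesis by (simp add: find_time_def)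
qed

lemma reach_time_attained:
  assumes "trajectory b (run A y i)" "0 \<le> t" "run A y i t = y"
  shows "0 \<le> reach_time A y i \<and> run A y i (reach_time A y i) = y"
proof -
  let ?S = "{t. 0 \<le> t \<and> run A y i t = y}"
  have "Inf ?S \<in> ?S"
    using assms by (intro closed_contains_Inf)
      (auto intro!: bdd_belowI[of _ 0] trajectory_closed_preimage)
  then show ?thesis by (simp add: reach_time_def)
qed

section \<open>Lower bounds for an arbitrary algorithm\<close>

lemma find_time_le:
  assumes "0 \<le> t" "search A i t = y"
  shows "find_time A y \<le> t"
  unfolding find_time_def using assms by (intro cInf_lower) (auto intro!: bdd_belowI[of _ 0])

text \<open>Before the discovery \<open>run\<close> agrees with \<open>search\<close>, so an earlier
  arrival would itself be an earlier discovery.\<close>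

lemma find_time_le_reach_time:
  assumes "0 \<le> reach_time A y i" "run A y i (reach_time A y i) = y"
  shows "find_time A y \<le> reach_time A y i"
proof (rule ccontr)
  assume "\<not> ?thesis"
  then have "search A i (reach_time A y i) = y"
    using assms(2) by (simp add: run_def)
  with \<open>\<not> ?thesis\<close> find_time_le[OF assms(1)] show False by blast
qed

lemma reach_time_le_evacuation_time: "reach_time A y i \<le> evacuation_time A y"
  by (cases i) (auto simp: evacuation_time_def)

text \<open>Cutting at \<open>t\<close> and \<open>u\<close> yields displacements
  \<open>\<bar>y\<bar>\<close> and \<open>2 * \<bar>y\<bar>\<close>, followed by a remainder about
  which nothing is known; the bounds for the three pieces are added.\<close>

lemma detour_bounds:
  assumes "moves b p 0 T E" "0 \<le> t" "t \<le> u" "u \<le> T" "0 \<le> b" "0 \<le> s"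
    and "p 0 = 0" "p t = y" "p u = - y"
  shows "3 * \<bar>y\<bar> \<le> b * T" "9 * s\<^sup>2 * \<bar>y\<bar> - 2 * s ^ 3 * T \<le> E"
proof -
  obtain E1 E' where 1: "moves b p 0 t E1" and "moves b p t T E'" and E: "E = E1 + E'"
    using assms(1-4) by (meson moves_split order_trans)
  then obtain E2 E3 where 2: "moves b p t u E2" and 3: "moves b p u T E3" and E': "E' = E2 + E3"
    using assms(3,4) by (meson moves_split)
  have "b * (T - u) \<ge> 0" using assms by simp
  then show "3 * \<bar>y\<bar> \<le> b * T"
    using 1[THEN moves_displacement_le] 2[THEN moves_displacement_le] assms(7-9)
    by (simp add: algebra_simps)
  \<comment> \<open>After time \<open>u\<close> the displacement term is dropped and only the
    duration term kept, so that the durations add up to \<open>T\<close>.\<close>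
  have "0 \<le> 3 * s\<^sup>2 * \<bar>p T - p u\<bar>" by simp
  then have "- (2 * s ^ 3 * (T - u)) \<le> E3"
    using moves_energy_ge[OF 3 assms(6)] by linarith
  moreover have "3 * s\<^sup>2 * \<bar>y\<bar> - 2 * s ^ 3 * t \<le> E1"
    using moves_energy_ge[OF 1 assms(6)] assms(7,8) by simp
  moreover have "\<bar>p u - p t\<bar> = 2 * \<bar>y\<bar>" using assms(8,9) by simp
  then have "6 * s\<^sup>2 * \<bar>y\<bar> - 2 * s ^ 3 * (u - t) \<le> E2"
    using moves_energy_ge[OF 2 assms(6)] by (simp add: mult_ac)
  ultimately show "9 * s\<^sup>2 * \<bar>y\<bar> - 2 * s ^ 3 * T \<le> E"
    unfolding E E' by (simp add: algebra_simps)
qed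

text \<open>Up to \<open>find_time A (- y)\<close> the run for \<open>- y\<close> is the bare
  search, so the assumption on the two find times makes the first visitor of \<open>y\<close> pass
  through \<open>y\<close> in that run too. The detour bounds apply with
  \<open>t = find_time A y\<close> and \<open>u\<close> the time at which this robot reaches
  \<open>- y\<close>.\<close>

lemma evacuation_bounds_opposite:
  assumes "evacuates b A y" "evacuates b A (- y)" "find_time A y \<le> find_time A (- y)"
    and "makespan_energy b A (- y) M" "0 \<le> b" "0 \<le> s"
  shows "3 * \<bar>y\<bar> \<le> b * evacuation_time A (- y)"
    and "9 * s\<^sup>2 * \<bar>y\<bar> - 2 * s ^ 3 * evacuation_time A (- y) \<le> M"
proof -
  obtain i where t0: "0 \<le> find_time A y" and i: "search A i (find_time A y) = y"
    using assms(1) find_time_attained[of b A _ _ y] unfolding evacuates_def by blast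
  have run_i: "run A (- y) i (find_time A y) = y"
    using i assms(3) by (simp add: run_def)
  have tr: "trajectory b (run A (- y) i)" using assms(2) by (simp add: evacuates_def)
  then have reach: "0 \<le> reach_time A (- y) i" "run A (- y) i (reach_time A (- y) i) = - y"
    using reach_time_attained assms(2) unfolding evacuates_def by blast+
  obtain E where E: "moves b (run A (- y) i) 0 (evacuation_time A (- y)) E" "E \<le> M"
    using assms(4) unfolding makespan_energy_def by (cases i) auto
  note b = detour_bounds[OF E(1) t0 order_trans[OF assms(3) find_time_le_reach_time[OF reach]]
      reach_time_le_evacuation_time assms(5,6) _ run_i reach(2)]
  show "3 * \<bar>y\<bar> \<le> b * evacuation_time A (- y)"
    using b(1) tr by (simp add: trajectory_def)
  show "9 * s\<^sup>2 * \<bar>y\<bar> - 2 * s ^ 3 * evacuation_time A (- y) \<le> M"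
    using b(2) tr E(2) by (simp add: trajectory_def)
qed

lemma worst_time_bounds:
  assumes "W_feasible b \<Delta> A" "0 < d" "0 \<le> b" "0 \<le> s"
  shows "3 * d \<le> b * worst_time A d"
    and "9 * s\<^sup>2 * d - 2 * s ^ 3 * worst_time A d \<le> \<Delta> d"
proof -
  \<comment> \<open>One of the two sides is visited no later than the other; the adversary places
    the exit on the other one.\<close>
  have "\<exists>y\<in>{d, - d}. find_time A y \<le> find_time A (- y)" by force
  then obtain y where y: "y \<in> {d, - d}" "find_time A y \<le> find_time A (- y)" by blast
  have my: "- y \<in> {d, - d}" "\<bar>y\<bar> = d" using y(1) assms(2) by auto
  obtain M where M: "makespan_energy b A (- y) M" "M \<le> \<Delta> d"
    using assms(1,2) my(1) unfolding W_feasible_def by blast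
  have ev: "evacuates b A y" "evacuates b A (- y)"
    using assms(1,2) y(1) my(1) unfolding W_feasible_def by blast+
  note bd = evacuation_bounds_opposite[OF ev y(2) M(1) assms(3,4), unfolded my(2)]
  have le: "evacuation_time A (- y) \<le> worst_time A d"
    using my(1) by (auto simp: worst_time_def)
  show "3 * d \<le> b * worst_time A d"
    using bd(1) mult_left_mono[OF le assms(3)] by simp
  \<comment> \<open>The time enters with a nonpositive coefficient, so replacing it by the larger
    \<open>worst_time\<close> only weakens the bound.\<close>
  show "9 * s\<^sup>2 * d - 2 * s ^ 3 * worst_time A d \<le> \<Delta> d"
    using bd(2) M(2) mult_left_mono[OF le, of "2 * s ^ 3"] assms(4) by simp
qed

section \<open>Motion, evacuation time and energy of the naive algorithm\<close>

text \<open>A sign for each robot, which treats both sides of the exit uniformly: the finder of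
  \<open>y\<close> is the robot with heading \<open>sgn y\<close>.\<close>

definition heading :: "robot \<Rightarrow> real" where
  "heading i = (case i of Robot1 \<Rightarrow> 1 | Robot2 \<Rightarrow> - 1)"

lemma naive_search_heading: "naive_search s i t = heading i * (s * t)"
  by (cases i) (simp_all add: naive_search_def heading_def)

lemma search_naive: "search (naive s r) i t = heading i * (s * t)"
  by (simp add: naive_def naive_search_heading)

lemma respond_naive:
  "respond (naive s r) y i u =
    (let x = heading i * (s * (\<bar>y\<bar> / s))
     in if x = y then y else x + sgn (y - x) * min (r * u) \<bar>y - x\<bar>)"
  by (simp only: naive_def naive_search_heading algorithm.simps)

lemma heading_cases: "heading i = sgn y \<or> heading i = - sgn y" if "y \<noteq> 0"
  using that by (cases i) (auto simp: heading_def sgn_if)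

lemma ex_heading:
  assumes "y \<noteq> 0"
  obtains i where "heading i = sgn y"
  using assms that[of Robot1] that[of Robot2] by (cases "0 < y") (auto simp: heading_def)

lemma find_time_naive:
  assumes "0 < s" "y \<noteq> 0"
  shows "find_time (naive s r) y = \<bar>y\<bar> / s"
proof -
  have "{t. 0 \<le> t \<and> (\<exists>i. search (naive s r) i t = y)} = {\<bar>y\<bar> / s}"
  proof (intro equalityI subsetI)
    fix t assume "t \<in> {t. 0 \<le> t \<and> (\<exists>i. search (naive s r) i t = y)}"
    then obtain i where "0 \<le> t" "heading i * (s * t) = y"
      by (auto simp: search_naive)
    then have "\<bar>y\<bar> = s * t" using assms by (cases i) (auto simp: heading_def)
    then show "t \<in> {\<bar>y\<bar> / s}" using assms by simp
  next
    fix t assume "t \<in> {\<bar>y\<bar> / s}"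
    moreover obtain i where "heading i = sgn y" using assms(2) by (rule ex_heading)
    ultimately have "0 \<le> t" "search (naive s r) i t = y"
      using assms by (auto simp: search_naive sgn_mult_abs)
    then show "t \<in> {t. 0 \<le> t \<and> (\<exists>i. search (naive s r) i t = y)}" by blast
  qed
  then show ?thesis by (simp add: find_time_def)
qed

lemma run_naive_finder:
  assumes "0 < s" "y \<noteq> 0" "heading i = sgn y"
  shows "run (naive s r) y i t = (if t \<le> \<bar>y\<bar> / s then sgn y * (s * t) else y)"
  using assms
  by (simp add: run_def find_time_naive search_naive respond_naive sgn_mult_abs)

text \<open>At the announcement this robot stands at \<open>- y\<close>, so at speed
  \<open>s\<close> the return over \<open>2 * \<bar>y\<bar>\<close> ends at time
  \<open>3 * \<bar>y\<bar> / s\<close>.\<close>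

lemma run_naive_other:
  assumes "0 < s" "y \<noteq> 0" "heading i = - sgn y"
  shows "run (naive s s) y i t =
    (if t \<le> \<bar>y\<bar> / s then - (sgn y * (s * t))
     else if t \<le> 3 * \<bar>y\<bar> / s then sgn y * (s * t - 2 * \<bar>y\<bar>) else y)"
proof -
  have x: "heading i * (s * (\<bar>y\<bar> / s)) = - y"
    using assms by (simp add: sgn_mult_abs)
  have "s * (t - \<bar>y\<bar> / s) = s * t - \<bar>y\<bar>"
    using assms by (simp add: right_diff_distrib)
  moreover have "t \<le> 3 * \<bar>y\<bar> / s \<longleftrightarrow> s * t \<le> 3 * \<bar>y\<bar>"
    using assms by (simp add: pos_le_divide_eq mult.commute)
  moreover have "y + y \<noteq> 0" "- y \<noteq> y" using assms by simp_all
  moreover have "sgn (2 * y) = sgn y" "\<bar>y\<bar> * sgn y = y" by (simp_all add: sgn_mult abs_mult_sgn)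
  ultimately show ?thesis
    using assms x
    by (auto simp: run_def find_time_naive search_naive respond_naive min_def abs_mult
        algebra_simps)
qed

text \<open>Motion up to a late time can be cut at any earlier one, so only times after the last
  change of velocity need explicit treatment.\<close>

lemma trajectoryI:
  assumes "p 0 = 0" "\<And>T. T \<ge> K \<Longrightarrow> \<exists>E. moves b p 0 T E"
  shows "trajectory b p"
  unfolding trajectory_def
proof (intro conjI allI impI)
  fix T :: real assume "0 \<le> T"
  obtain E where "moves b p 0 (max T K) E" using assms(2)[of "max T K"] by auto
  then show "\<exists>E. moves b p 0 T E" using \<open>0 \<le> T\<close> by (meson max.cobounded1 moves_split)
qed (fact assms(1))

lemma moves_naive_finder:
  assumes "0 < s" "s \<le> b" "y \<noteq> 0" "heading i = sgn y" "\<bar>y\<bar> / s \<le> T"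
  shows "moves b (run (naive s r) y i) 0 T (s\<^sup>2 * \<bar>y\<bar>)"
proof -
  let ?p = "run (naive s r) y i" and ?t = "\<bar>y\<bar> / s"
  note p = run_naive_finder[OF assms(1,3,4), of r]
  have v: "\<bar>sgn y * s\<bar> = s" using assms by (simp add: abs_mult)
  have "moves b ?p 0 ?t (\<bar>sgn y * s\<bar> ^ 3 * (?t - 0))"
    using assms v by (intro moves_linear[where q = 0]) (auto simp: p)
  moreover have "moves b ?p ?t T (\<bar>0\<bar> ^ 3 * (T - ?t))"
    using assms by (intro moves_linear[where q = y]) (auto simp: p sgn_mult_abs)
  ultimately have "moves b ?p 0 T (\<bar>sgn y * s\<bar> ^ 3 * (?t - 0) + \<bar>0\<bar> ^ 3 * (T - ?t))"
    by (rule moves.add)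
  then show ?thesis
    using assms(1) unfolding v by (simp add: power3_eq_cube power2_eq_square mult.assoc)
qed

lemma moves_naive_other:
  assumes "0 < s" "s \<le> b" "y \<noteq> 0" "heading i = - sgn y" "3 * \<bar>y\<bar> / s \<le> T"
  shows "moves b (run (naive s s) y i) 0 T (3 * s\<^sup>2 * \<bar>y\<bar>)"
proof -
  let ?p = "run (naive s s) y i" and ?t = "\<bar>y\<bar> / s" and ?u = "3 * \<bar>y\<bar> / s"
  note p = run_naive_other[OF assms(1,3,4)]
  have v: "\<bar>sgn y * s\<bar> = s" "\<bar>- sgn y * s\<bar> = s" using assms by (simp_all add: abs_mult)
  have tu: "?t \<le> ?u" using assms by (simp add: divide_right_mono)
  have "moves b ?p 0 ?t (\<bar>- sgn y * s\<bar> ^ 3 * (?t - 0))"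
    using assms v by (intro moves_linear[where q = 0]) (auto simp: p)
  moreover have "moves b ?p ?t ?u (\<bar>sgn y * s\<bar> ^ 3 * (?u - ?t))"
  \<comment> \<open>The line of slope \<open>sgn y * s\<close> through position \<open>- y\<close>
    at time \<open>\<bar>y\<bar> / s\<close> has intercept \<open>- 2 * y\<close>.\<close>
  proof (rule moves_linear[where q = "- 2 * y"])
    fix t assume "?t \<le> t" "t \<le> ?u"
    then show "?p t = - 2 * y + sgn y * s * t"
      using assms(1) by (cases "t = ?t") (auto simp: p abs_mult_sgn algebra_simps)
  qed (use v tu assms in auto)
  ultimately have "moves b ?p 0 ?u (\<bar>- sgn y * s\<bar> ^ 3 * (?t - 0) + \<bar>sgn y * s\<bar> ^ 3 * (?u - ?t))"
    by (rule moves.add)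
  moreover have "moves b ?p ?u T (\<bar>0\<bar> ^ 3 * (T - ?u))"
  proof (rule moves_linear[where q = y])
    fix t assume "?u \<le> t" "t \<le> T"
    \<comment> \<open>This excludes the outward branch, as \<open>?u = ?t\<close> would force
      \<open>y = 0\<close>. The instant \<open>t = ?u\<close> still belongs to the return branch and
      is checked separately.\<close>
    moreover from this tu have "t \<le> ?t \<Longrightarrow> ?u = ?t" by linarith
    ultimately show "?p t = y + 0 * t"
      using assms(1,3) by (cases "t = ?u") (auto simp: p abs_mult_sgn algebra_simps)
  qed (use assms in auto)
  ultimately have "moves b ?p 0 T (\<bar>- sgn y * s\<bar> ^ 3 * (?t - 0) + \<bar>sgn y * s\<bar> ^ 3 * (?u - ?t)
      + \<bar>0\<bar> ^ 3 * (T - ?u))"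
    by (rule moves.add)
  moreover have "s ^ 3 * (?t - 0) + s ^ 3 * (?u - ?t) + \<bar>0\<bar> ^ 3 * (T - ?u) = 3 * s\<^sup>2 * \<bar>y\<bar>"
    using assms(1) by (simp add: power3_eq_cube power2_eq_square field_simps)
  ultimately show ?thesis unfolding v by simp
qed

lemma run_naive_0: "0 < s \<Longrightarrow> y \<noteq> 0 \<Longrightarrow> run (naive s r) y i 0 = 0"
  by (simp add: run_def find_time_naive search_naive)

lemma trajectory_run_naive:
  assumes "0 < s" "s \<le> b" "y \<noteq> 0"
  shows "trajectory b (run (naive s s) y i)"
proof (rule trajectoryI[where K = "3 * \<bar>y\<bar> / s"])
  fix T assume T: "3 * \<bar>y\<bar> / s \<le> T"
  moreover have "\<bar>y\<bar> / s \<le> 3 * \<bar>y\<bar> / s" using assms by (simp add: divide_right_mono)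
  ultimately have "\<bar>y\<bar> / s \<le> T" by linarith
  with T show "\<exists>E. moves b (run (naive s s) y i) 0 T E"
    using heading_cases[OF assms(3), of i] moves_naive_finder[OF assms] moves_naive_other[OF assms]
    by blast
qed (use assms run_naive_0 in simp)

lemma trajectory_search_naive:
  assumes "0 < s" "s \<le> b"
  shows "trajectory b (search (naive s r) i)"
proof (rule trajectoryI[where K = 0])
  fix T :: real assume "0 \<le> T"
  moreover have "\<bar>heading i * s\<bar> \<le> b" using assms by (cases i) (simp_all add: heading_def)
  ultimately have "moves b (search (naive s r) i) 0 T (\<bar>heading i * s\<bar> ^ 3 * (T - 0))"
    by (intro moves_linear[where q = 0]) (auto simp: search_naive)
  then show "\<exists>E. moves b (search (naive s r) i) 0 T E" by blast
qed (simp add: search_naive)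

lemma reach_time_naive_finder:
  assumes "0 < s" "y \<noteq> 0" "heading i = sgn y"
  shows "reach_time (naive s r) y i = \<bar>y\<bar> / s"
proof -
  have "\<bar>y\<bar> / s \<le> t" if "0 \<le> t" "run (naive s r) y i t = y" for t
  proof (rule ccontr)
    assume "\<not> ?thesis"
    then have "sgn y * (s * t) = y" "s * t < \<bar>y\<bar>"
      using that assms by (auto simp: run_naive_finder field_simps)
    then show False using that assms by (auto simp: sgn_if split: if_splits)
  qed
  moreover have "run (naive s r) y i (\<bar>y\<bar> / s) = y"
    using assms by (simp add: run_naive_finder sgn_mult_abs)
  ultimately show ?thesis
    unfolding reach_time_def using assms by (intro cInf_eq_minimum) auto
qed

text \<open>Measured in direction \<open>sgn y\<close>, the robot is at \<open>- (s * t)\<close> on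
  the way out and at \<open>s * t - 2 * \<bar>y\<bar>\<close> on the way back; both stay below
  \<open>\<bar>y\<bar>\<close> until the claimed time.\<close>

lemma reach_time_naive_other:
  assumes "0 < s" "y \<noteq> 0" "heading i = - sgn y"
  shows "reach_time (naive s s) y i = 3 * \<bar>y\<bar> / s"
proof -
  have "3 * \<bar>y\<bar> / s \<le> t" if "0 \<le> t" "run (naive s s) y i t = y" for t
  proof (rule ccontr)
    assume "\<not> ?thesis"
    then have lt: "s * t < 3 * \<bar>y\<bar>" "t \<le> 3 * \<bar>y\<bar> / s" using assms by (auto simp: field_simps)
    have "0 \<le> s * t" using that assms by simp
    then show False
      using that lt assms by (auto simp: run_naive_other sgn_if split: if_splits)
  qed
  moreover have "\<not> 3 * \<bar>y\<bar> / s \<le> \<bar>y\<bar> / s" using assms by (simp add: field_simps)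
  then have "run (naive s s) y i (3 * \<bar>y\<bar> / s) = y"
    using assms by (simp add: run_naive_other sgn_mult_abs)
  ultimately show ?thesis
    unfolding reach_time_def using assms by (intro cInf_eq_minimum) auto
qed

lemma evacuation_time_naive:
  assumes "0 < s" "y \<noteq> 0"
  shows "evacuation_time (naive s s) y = 3 * \<bar>y\<bar> / s"
proof -
  have le: "\<bar>y\<bar> / s \<le> 3 * \<bar>y\<bar> / s" using assms by (simp add: divide_right_mono)
  show ?thesis
  proof (cases "0 < y")
    case True
    then have "heading Robot1 = sgn y" "heading Robot2 = - sgn y" by (simp_all add: heading_def)
    then show ?thesis
      using assms le
      by (simp add: evacuation_time_def reach_time_naive_finder reach_time_naive_other max_def)
  next
    case False
    then have "heading Robot2 = sgn y" "heading Robot1 = - sgn y"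
      using assms by (simp_all add: heading_def)
    then show ?thesis
      using assms le
      by (simp add: evacuation_time_def reach_time_naive_finder reach_time_naive_other max_def)
  qed
qed

text \<open>The time \<open>3 * \<bar>y\<bar> / s\<close> is a witness for both robots, since the
  finder waits at the exit.\<close>

lemma evacuates_naive:
  assumes "0 < s" "s \<le> b" "y \<noteq> 0"
  shows "evacuates b (naive s s) y"
proof -
  have "\<not> 3 * \<bar>y\<bar> / s \<le> \<bar>y\<bar> / s" using assms by (simp add: field_simps)
  then have "run (naive s s) y i (3 * \<bar>y\<bar> / s) = y" for i
    using heading_cases[OF assms(3), of i] assms
    by (auto simp: run_naive_finder run_naive_other sgn_mult_abs)
  moreover have "0 \<le> 3 * \<bar>y\<bar> / s" "0 \<le> \<bar>y\<bar> / s" using assms by simp_all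
  moreover obtain i where "heading i = sgn y" using assms(3) by (rule ex_heading)
  then have "search (naive s s) i (\<bar>y\<bar> / s) = y"
    using assms by (simp add: search_naive sgn_mult_abs)
  ultimately show ?thesis
    unfolding evacuates_def
    using trajectory_search_naive[OF assms(1,2)] trajectory_run_naive[OF assms] by blast
qed

lemma makespan_energy_naive:
  assumes "0 < s" "s \<le> b" "y \<noteq> 0"
  shows "makespan_energy b (naive s s) y (3 * s\<^sup>2 * \<bar>y\<bar>)"
proof -
  let ?T = "3 * \<bar>y\<bar> / s"
  have "\<bar>y\<bar> / s \<le> ?T" using assms by (simp add: divide_right_mono)
  note m = moves_naive_finder[OF assms _ this, of _ s] moves_naive_other[OF assms _ order_refl]
  have "s\<^sup>2 * \<bar>y\<bar> \<le> 3 * s\<^sup>2 * \<bar>y\<bar>" by (intro mult_right_mono) auto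
  \<comment> \<open>The returning robot dominates. Both orders of \<open>max\<close> are stated
    because the side of the exit decides which robot is the finder.\<close>
  then have mx: "3 * s\<^sup>2 * \<bar>y\<bar> = max (s\<^sup>2 * \<bar>y\<bar>) (3 * s\<^sup>2 * \<bar>y\<bar>)"
    "3 * s\<^sup>2 * \<bar>y\<bar> = max (3 * s\<^sup>2 * \<bar>y\<bar>) (s\<^sup>2 * \<bar>y\<bar>)" by simp_all
  show ?thesis
  proof (cases "0 < y")
    case True
    then have "heading Robot1 = sgn y" "heading Robot2 = - sgn y" by (simp_all add: heading_def)
    then show ?thesis
      unfolding makespan_energy_def evacuation_time_naive[OF assms(1,3)] using m mx by blast
  next
    case False
    then have "heading Robot2 = sgn y" "heading Robot1 = - sgn y"
      using assms by (simp_all add: heading_def)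
    then show ?thesis
      unfolding makespan_energy_def evacuation_time_naive[OF assms(1,3)] using m mx by blast
  qed
qed

section \<open>Matching the bounds: optimality of the naive algorithm\<close>

theorem theorem7:
  fixes e s r :: real and g :: "real \<Rightarrow> real"
  assumes "e > 0"
    and "s = (if e < 3 then sqrt (e / 3) else 1)"
    and "r = s"
    and "g = (\<lambda>e. if e < 3 then 3 * sqrt (3 / e) else 3)"
  shows "W_solution 1 (\<lambda>d. e * d) (naive s r) \<and>
    (\<forall>d>0. \<forall>y\<in>{d, - d}. evacuation_time (naive s r) y = g e * d)"
proof -
  have s: "0 < s" "s \<le> 1" "3 * s\<^sup>2 \<le> e"
    using assms(1,2) by auto
  have g: "g e = 3 / s"
    using assms(1,2,4) by (simp add: real_sqrt_divide)
  have time: "evacuation_time (naive s s) y = 3 * d / s" if "0 < d" "y \<in> {d, - d}" for d y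
    using that evacuation_time_naive[OF s(1), of y] by auto
  have "W_feasible 1 (\<lambda>d. e * d) (naive s s)"
    unfolding W_feasible_def
  proof (intro allI impI ballI conjI)
    fix d y :: real assume "0 < d" "y \<in> {d, - d}"
    then have y: "y \<noteq> 0" "\<bar>y\<bar> = d" by auto
    show "evacuates 1 (naive s s) y" using s y by (intro evacuates_naive) auto
    have "3 * s\<^sup>2 * d \<le> e * d" using s(3) \<open>0 < d\<close> by simp
    then show "\<exists>M. makespan_energy 1 (naive s s) y M \<and> M \<le> e * d"
      using makespan_energy_naive[OF s(1,2) y(1)] y(2) by metis
  qed
  moreover have "worst_time (naive s s) d \<le> worst_time A d"
    if A: "W_feasible 1 (\<lambda>d. e * d) A" and d: "0 < d" for A d
  proof -
    note bd = worst_time_bounds[OF A d, of s]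
    have "3 * d \<le> s * worst_time A d"
    proof (cases "e < 3")
      case True
      then have e: "e = 3 * s\<^sup>2" using assms(1,2) by simp
      \<comment> \<open>With budget \<open>3 * s\<^sup>2 * d\<close>, the energy bound \<open>9 *
        s\<^sup>2 * d - 2 * s ^ 3 * worst_time A d \<le> 3 * s\<^sup>2 * d\<close> rearranges to
        this.\<close>
      have "(2 * s\<^sup>2) * (3 * d) \<le> (2 * s\<^sup>2) * (s * worst_time A d)"
        using bd(2) s(1) unfolding e by (simp add: power3_eq_cube power2_eq_square algebra_simps)
      then show ?thesis using s(1) by simp
    next
      case False
      \<comment> \<open>Here \<open>s = 1\<close> is the speed limit itself, and the bound on the
        distance walked suffices.\<close>
      then show ?thesis using bd(1) s assms(2) by simp
    qed
    then have "3 * d / s \<le> worst_time A d"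
      using s(1) by (simp add: pos_divide_le_eq mult.commute)
    then show ?thesis
      using time[OF d] by (simp add: worst_time_def[of "naive s s"])
  qed
  ultimately show ?thesis
    unfolding W_solution_def assms(3) g using time by simp
qed

end
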